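(* Let $n\ge1$, let $a\in\mathcal E_n''$, let $\varepsilon\in\{1,-1\}$, and consider $(\tilde a,\varepsilon a)\in\mathcal A_{n+1}$, for which $\chi=\gamma_n\frac{n(\tilde a)}{n(\varepsilon a)}=-\gamma_{n-1}\gamma_n$. (1) If $\chi=1$, then $(\tilde a,\varepsilon a)$ is orthogonal to itself, to $(\tilde e_0,\varepsilon e_0)$, and to $(a,\varepsilon\gamma_n\tilde a)$. (2) If $\chi=-1$, then $(\tilde a,\varepsilon a)$ is adjacent in $\Gamma_e(\mathcal A_{n+1})$ to all $(\tilde b,-\varepsilon b)$ such that $b\in\mathcal E_n''\setminus\{a,\tilde a,-\tilde a\}$, and only to them. Besides, in this case $(\tilde a,\varepsilon a)$ is a zero divisor in $\mathcal A_{n+1}$, i.e. (up to sign) belongs to $Z_e'(\mathcal A_{n+1})$, if and only if $n\ge3$.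
   Context: Real Cayley–Dickson algebras: $\mathcal A_0=\mathbb R$ with trivial involution. Given parameters $\gamma_0,\gamma_1,\dots\in\{\pm1\}$ (the paper's normalization of nonzero real parameters), $\mathcal A_{k+1}=\mathcal A_k\times\mathcal A_k$ with componentwise addition and real scaling, product $(a,b)(c,d)=(ac+\gamma_k\bar d b,\ da+b\bar c)$ and involution $\overline{(a,b)}=(\bar a,-b)$. The norm is $n(a)=a\bar a\in\mathbb R$. Standard basis: $e^{(0)}_0=1$; $e^{(k+1)}_j=(e^{(k)}_j,0)$ for $0\le j<2^k$ and $e^{(k+1)}_j=(0,e^{(k)}_{j-2^k})$ for $2^k\le j<2^{k+1}$; $e_0=e_0^{(n)}$ is the unity. In $\mathcal A_n$, $\tilde e_0=(0,e_0)=e^{(n)}_{2^{n-1}}$ and $\tilde x=x\tilde e_0$. $\mathcal E_n=\{e_0^{(n)},\dots,e^{(n)}_{2^n-1}\}$, $\mathcal E_n'=\mathcal E_n\setminus\{e_0\}$, $\mathcal E_n''=\mathcal E_n\setminus\{e_0,\tilde e_0\}$. $Z_e'(\mathcal A_{n+1})$ is the set of zero divisors of $\mathcal A_{n+1}$ of the form $(x,y)$ with $x\in\mathcal E_n'$, $y\in\pm\mathcal E_n$; zero divisors are considered up to multiplication by $\pm1$. Elements $x,y$ are orthogonal if $xy=yx=0$. $\Gamma_e(\mathcal A_{n+1})$ is the graph whose vertices are the lines $\mathbb R x$, $x\in Z_e'(\mathcal A_{n+1})$, distinct vertices being adjacent iff they are orthogonal (an element is identified with its line). A zero divisor is a nonzero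 $x$ with $xy=0$ or $yx=0$ for some $y\neq0$. *)

theory Defs
  imports Complex_Main
begin

text \<open>
  All Cayley--Dickson algebras share one datatype of nested pairs of reals; the algebra of
  level \<open>k\<close> is the carrier \<open>cd_alg k\<close> of trees of uniform depth \<open>k\<close>, so that a statement can
  quantify over the level.  Operations on elements of different shape are unspecified.
\<close>

datatype cd = CD_Real real | CD_Pair cd cd

fun cd_alg :: "nat \<Rightarrow> cd set" where
  "cd_alg 0 = range CD_Real"
| "cd_alg (Suc k) = {CD_Pair a b | a b. a \<in> cd_alg k \<and> b \<in> cd_alg k}"

fun cd_add :: "cd \<Rightarrow> cd \<Rightarrow> cd" where
  "cd_add (CD_Real x) (CD_Real y) = CD_Real (x + y)"
| "cd_add (CD_Pair a b) (CD_Pair c d) = CD_Pair (cd_add a c) (cd_add b d)"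

fun cd_scale :: "real \<Rightarrow> cd \<Rightarrow> cd" where
  "cd_scale r (CD_Real x) = CD_Real (r * x)"
| "cd_scale r (CD_Pair a b) = CD_Pair (cd_scale r a) (cd_scale r b)"

abbreviation cd_neg :: "cd \<Rightarrow> cd" where
  "cd_neg \<equiv> cd_scale (- 1)"

fun cd_zero :: "nat \<Rightarrow> cd" where
  "cd_zero 0 = CD_Real 0"
| "cd_zero (Suc k) = CD_Pair (cd_zero k) (cd_zero k)"

fun cd_conj :: "cd \<Rightarrow> cd" where
  "cd_conj (CD_Real x) = CD_Real x"
| "cd_conj (CD_Pair a b) = CD_Pair (cd_conj a) (cd_neg b)"

text \<open>The level is an argument because the doubling parameter \<open>\<gamma> k\<close> depends on it.\<close>

fun cd_mult :: "(nat \<Rightarrow> real) \<Rightarrow> nat \<Rightarrow> cd \<Rightarrow> cd \<Rightarrow> cd" where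
  "cd_mult \<gamma> 0 (CD_Real x) (CD_Real y) = CD_Real (x * y)"
| "cd_mult \<gamma> (Suc k) (CD_Pair a b) (CD_Pair c d) =
     CD_Pair (cd_add (cd_mult \<gamma> k a c) (cd_scale (\<gamma> k) (cd_mult \<gamma> k (cd_conj d) b)))
             (cd_add (cd_mult \<gamma> k d a) (cd_mult \<gamma> k b (cd_conj c)))"

text \<open>\<open>cd_basis k j\<close> is the standard basis element \<open>e\<^sub>j\<close> of level \<open>k\<close>; only \<open>j < 2 ^ k\<close> is meaningful.\<close>

fun cd_basis :: "nat \<Rightarrow> nat \<Rightarrow> cd" where
  "cd_basis 0 j = CD_Real 1"
| "cd_basis (Suc k) j =
     (if j < 2 ^ k then CD_Pair (cd_basis k j) (cd_zero k)
      else CD_Pair (cd_zero k) (cd_basis k (j - 2 ^ k)))"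

abbreviation cd_one :: "nat \<Rightarrow> cd" where
  "cd_one k \<equiv> cd_basis k 0"

text \<open>The norm is the real number identified with \<open>a \<cdot> conj a\<close>, a real multiple of the unity.\<close>

definition cd_norm :: "(nat \<Rightarrow> real) \<Rightarrow> nat \<Rightarrow> cd \<Rightarrow> real" where
  "cd_norm \<gamma> k a = (THE r. cd_mult \<gamma> k a (cd_conj a) = cd_scale r (cd_one k))"

text \<open>The element \<open>(0, e\<^sub>0)\<close>; only meaningful for \<open>n \<ge> 1\<close>.\<close>

definition cd_te0 :: "nat \<Rightarrow> cd" where
  "cd_te0 n = cd_basis n (2 ^ (n - 1))"

definition cd_tilde :: "(nat \<Rightarrow> real) \<Rightarrow> nat \<Rightarrow> cd \<Rightarrow> cd" where
  "cd_tilde \<gamma> n x = cd_mult \<gamma> n x (cd_te0 n)"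

definition cd_E :: "nat \<Rightarrow> cd set" where
  "cd_E n = cd_basis n ` {..<2 ^ n}"

definition cd_E' :: "nat \<Rightarrow> cd set" where
  "cd_E' n = cd_E n - {cd_one n}"

definition cd_E'' :: "nat \<Rightarrow> cd set" where
  "cd_E'' n = cd_E n - {cd_one n, cd_te0 n}"

definition cd_zero_divisor :: "(nat \<Rightarrow> real) \<Rightarrow> nat \<Rightarrow> cd \<Rightarrow> bool" where
  "cd_zero_divisor \<gamma> k x \<longleftrightarrow> x \<in> cd_alg k \<and> x \<noteq> cd_zero k \<and>
     (\<exists>y \<in> cd_alg k. y \<noteq> cd_zero k \<and>
        (cd_mult \<gamma> k x y = cd_zero k \<or> cd_mult \<gamma> k y x = cd_zero k))"

definition cd_orth :: "(nat \<Rightarrow> real) \<Rightarrow> nat \<Rightarrow> cd \<Rightarrow> cd \<Rightarrow> bool" where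
  "cd_orth \<gamma> k x y \<longleftrightarrow> cd_mult \<gamma> k x y = cd_zero k \<and> cd_mult \<gamma> k y x = cd_zero k"

definition cd_line :: "cd \<Rightarrow> cd set" where
  "cd_line x = range (\<lambda>r. cd_scale r x)"

text \<open>
  Index shift: in the next three definitions the argument \<open>n\<close> refers to the algebra of
  level \<open>n + 1\<close>, whose elements are pairs of elements of level \<open>n\<close>.
\<close>

definition cd_Ze' :: "(nat \<Rightarrow> real) \<Rightarrow> nat \<Rightarrow> cd set" where
  "cd_Ze' \<gamma> n = {CD_Pair x y | x y.
     x \<in> cd_E' n \<and> y \<in> cd_E n \<union> cd_neg ` cd_E n \<and> cd_zero_divisor \<gamma> (Suc n) (CD_Pair x y)}"

definition Gamma_e_verts :: "(nat \<Rightarrow> real) \<Rightarrow> nat \<Rightarrow> cd set set" where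
  "Gamma_e_verts \<gamma> n = cd_line ` cd_Ze' \<gamma> n"

definition Gamma_e_adj :: "(nat \<Rightarrow> real) \<Rightarrow> nat \<Rightarrow> cd set \<Rightarrow> cd set \<Rightarrow> bool" where
  "Gamma_e_adj \<gamma> n L M \<longleftrightarrow> L \<in> Gamma_e_verts \<gamma> n \<and> M \<in> Gamma_e_verts \<gamma> n \<and> L \<noteq> M \<and>
     (\<forall>x \<in> L. \<forall>y \<in> M. cd_orth \<gamma> (Suc n) x y)"

end

(*
  Up to sign, the product of two basis elements is a basis element, distinct basis elements other
  than the unity anticommute, and x can be cancelled from xy ~ xz.  Write e = (0, 1).  For basis
  elements a, b away from 1, e and with b not in {a, ae, -ae}, going through the four positions of
  a and b in the doubling gives (ae)(be) = -\<gamma>(n-1) ba and b(ae) = -a(be), so the product of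
  (ae, \<epsilon>a) and (be, \<delta>b) has components proportional to \<gamma>(n-1) + \<gamma>(n) \<epsilon>\<delta> and to \<epsilon> + \<delta>.
  Conversely, if (c, d) with c, d basis elements up to sign kills (ae, \<epsilon>a), then the relation
  (ae)(be) ~ ba and cancellation force c ~ de, which leaves only the pairs above and the
  exceptional d = 1, a, ae.  A basis element b as above exists once n >= 3; for n = 2 the linear
  equations uy = 0 and yu = 0 with u = (ae, \<epsilon>a) are solved directly.
*)
theory Submission
  imports Defs
begin

subsection \<open>Linear structure\<close>

lemma cd_scale_scale [simp]: "cd_scale r (cd_scale s x) = cd_scale (r * s) x"
  by (induction x) auto

lemma cd_scale_1 [simp]: "cd_scale 1 x = x"
  by (induction x) auto

lemma cd_add_scale: "cd_add (cd_scale r x) (cd_scale s x) = cd_scale (r + s) x"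
  by (induction x) (auto simp: distrib_right)

lemma cd_conj_scale [simp]: "cd_conj (cd_scale r x) = cd_scale r (cd_conj x)"
  by (induction x) (auto simp: mult.commute)

lemma cd_scale_zero [simp]: "cd_scale r (cd_zero k) = cd_zero k"
  by (induction k) auto

lemma cd_conj_zero [simp]: "cd_conj (cd_zero k) = cd_zero k"
  by (induction k) auto

lemma cd_zero_closed [simp]: "cd_zero k \<in> cd_alg k"
  by (induction k) auto

lemma cd_scale_closed [simp]: "x \<in> cd_alg k \<Longrightarrow> cd_scale r x \<in> cd_alg k"
  by (induction k arbitrary: x) auto

lemma cd_add_closed [simp]: "x \<in> cd_alg k \<Longrightarrow> y \<in> cd_alg k \<Longrightarrow> cd_add x y \<in> cd_alg k"
  by (induction k arbitrary: x y) auto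

lemma cd_conj_closed [simp]: "x \<in> cd_alg k \<Longrightarrow> cd_conj x \<in> cd_alg k"
  by (induction k arbitrary: x) auto

lemma cd_mult_closed [simp]: "x \<in> cd_alg k \<Longrightarrow> y \<in> cd_alg k \<Longrightarrow> cd_mult \<gamma> k x y \<in> cd_alg k"
  by (induction k arbitrary: x y) auto

lemma cd_scale_0 [simp]: "x \<in> cd_alg k \<Longrightarrow> cd_scale 0 x = cd_zero k"
  by (induction k arbitrary: x) auto

lemma cd_add_zero_right [simp]: "x \<in> cd_alg k \<Longrightarrow> cd_add x (cd_zero k) = x"
  by (induction k arbitrary: x) auto

lemma cd_add_zero_left [simp]: "x \<in> cd_alg k \<Longrightarrow> cd_add (cd_zero k) x = x"
  by (induction k arbitrary: x) auto

lemma cd_scale_add: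
  "x \<in> cd_alg k \<Longrightarrow> y \<in> cd_alg k \<Longrightarrow> cd_scale r (cd_add x y) = cd_add (cd_scale r x) (cd_scale r y)"
  by (induction k arbitrary: x y) (auto simp: distrib_left)

lemma cd_scale_eq_zero_iff:
  "x \<in> cd_alg k \<Longrightarrow> cd_scale r x = cd_zero k \<longleftrightarrow> r = 0 \<or> x = cd_zero k"
  by (induction k arbitrary: x) auto

lemma cd_add_eq_zeroD:
  "x \<in> cd_alg k \<Longrightarrow> y \<in> cd_alg k \<Longrightarrow> cd_add x y = cd_zero k \<Longrightarrow> x = cd_neg y"
  by (induction k arbitrary: x y) auto

lemma cd_scale_inject:
  "x \<in> cd_alg k \<Longrightarrow> x \<noteq> cd_zero k \<Longrightarrow> cd_scale r x = cd_scale s x \<longleftrightarrow> r = s"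
  by (induction k arbitrary: x) auto

text \<open>Both sides are proved in one induction: the terms \<open>(conj d) b\<close> and
  \<open>d a\<close> of the doubled product reverse the order of the factors, so each side uses the
  other one level down.\<close>

lemma cd_mult_scale_left:
  "x \<in> cd_alg k \<Longrightarrow> y \<in> cd_alg k \<Longrightarrow> cd_mult \<gamma> k (cd_scale r x) y = cd_scale r (cd_mult \<gamma> k x y)"
  and cd_mult_scale_right:
  "x \<in> cd_alg k \<Longrightarrow> y \<in> cd_alg k \<Longrightarrow> cd_mult \<gamma> k x (cd_scale r y) = cd_scale r (cd_mult \<gamma> k x y)"
proof (induction k arbitrary: x y)
  case (Suc k)
  note cd_scale_add[of _ k, simp]
  { case 1
    with Suc show ?case by (auto simp: mult.commute)
  next
    case 2
    with Suc show ?case by (auto simp: mult.commute)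
  }
qed auto

lemmas cd_mult_scale = cd_mult_scale_left cd_mult_scale_right

lemma cd_mult_zero_left [simp]: "x \<in> cd_alg k \<Longrightarrow> cd_mult \<gamma> k (cd_zero k) x = cd_zero k"
  and cd_mult_zero_right [simp]: "x \<in> cd_alg k \<Longrightarrow> cd_mult \<gamma> k x (cd_zero k) = cd_zero k"
  by (induction k arbitrary: x) auto

lemma cd_conj_one [simp]: "cd_conj (cd_one k) = cd_one k"
  by (induction k) auto

lemma cd_mult_one_left [simp]: "x \<in> cd_alg k \<Longrightarrow> cd_mult \<gamma> k (cd_one k) x = x"
  and cd_mult_one_right [simp]: "x \<in> cd_alg k \<Longrightarrow> cd_mult \<gamma> k x (cd_one k) = x"
  by (induction k arbitrary: x) auto

section \<open>Orthogonality and lines under rescaling\<close>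

lemma cd_orth_scale:
  assumes "x \<in> cd_alg k" "y \<in> cd_alg k" "cd_orth \<gamma> k x y"
  shows "cd_orth \<gamma> k (cd_scale r x) (cd_scale s y)"
  using assms by (simp add: cd_orth_def cd_mult_scale)

lemma cd_line_self: "x \<in> cd_line x"
  unfolding cd_line_def by (metis cd_scale_1 rangeI)

lemma cd_line_scale:
  assumes "r \<noteq> 0"
  shows "cd_line (cd_scale r x) = cd_line x"
proof -
  have "range (\<lambda>s. s * r) = UNIV"
    using assms by (intro surjI[of _ "\<lambda>s. s / r"]) simp
  moreover have "range (\<lambda>s. cd_scale (s * r) x) = (\<lambda>s. cd_scale s x) ` range (\<lambda>s. s * r)"
    by (simp only: image_image)
  ultimately show ?thesis
    by (simp only: cd_line_def cd_scale_scale)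
qed

subsection \<open>Basis elements\<close>

lemma cd_E_0: "cd_E 0 = {CD_Real 1}"
  by (auto simp: cd_E_def)

text \<open>The index set splits at \<open>2 ^ k\<close> into two copies of itself. Later inductions
  run over the shapes (p, 0) and (0, p) instead of over indices.\<close>

lemma cd_E_Suc:
  "cd_E (Suc k) = (\<lambda>p. CD_Pair p (cd_zero k)) ` cd_E k \<union> (\<lambda>p. CD_Pair (cd_zero k) p) ` cd_E k"
proof -
  have "x \<in> (\<lambda>j. j + 2 ^ k) ` {..<2 ^ k}" if "x < 2 * 2 ^ k" "\<not> x < 2 ^ k" for x :: nat
    using that by (intro image_eqI[of _ _ "x - 2 ^ k"]) auto
  then have "{..<2 ^ Suc k} = {..<2 ^ k} \<union> (\<lambda>j. j + 2 ^ k) ` {..<2 ^ k :: nat}"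
    by auto
  then have "cd_E (Suc k) = cd_basis (Suc k) ` {..<2 ^ k}
      \<union> (\<lambda>j. cd_basis (Suc k) (j + 2 ^ k)) ` {..<2 ^ k}"
    unfolding cd_E_def by (simp only: image_Un image_image)
  also have "cd_basis (Suc k) ` {..<2 ^ k} = (\<lambda>p. CD_Pair p (cd_zero k)) ` cd_E k"
    by (simp add: cd_E_def image_image)
  also have "(\<lambda>j. cd_basis (Suc k) (j + 2 ^ k)) ` {..<2 ^ k} = (\<lambda>p. CD_Pair (cd_zero k) p) ` cd_E k"
    by (simp add: cd_E_def image_image)
  finally show ?thesis .
qed

lemma cd_one_in_E [simp]: "cd_one k \<in> cd_E k"
  by (simp add: cd_E_def)

lemma cd_E_closed [simp]: "p \<in> cd_E k \<Longrightarrow> p \<in> cd_alg k"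
  by (induction k arbitrary: p) (auto simp: cd_E_0 cd_E_Suc)

lemma cd_E_nonzero [simp]: "p \<in> cd_E k \<Longrightarrow> p \<noteq> cd_zero k"
  by (induction k arbitrary: p) (auto simp: cd_E_0 cd_E_Suc)

lemma cd_zero_notin_E [simp]: "cd_zero k \<notin> cd_E k"
  using cd_E_nonzero by blast

text \<open>A nonzero element determines its half, so the claim descends to level 0, where 1 is the
  only basis element. This turns proportionality of basis elements into equality.\<close>

lemma cd_E_scale_eqD: "p \<in> cd_E k \<Longrightarrow> q \<in> cd_E k \<Longrightarrow> p = cd_scale r q \<Longrightarrow> p = q \<and> r = 1"
proof (induction k arbitrary: p q)
  case 0
  then show ?case by (auto simp: cd_E_0)
next
  case (Suc k)
  then show ?case by (auto simp: cd_E_Suc; metis cd_zero_notin_E cd_E_nonzero)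
qed

lemma cd_conj_E: "p \<in> cd_E k \<Longrightarrow> p \<noteq> cd_one k \<Longrightarrow> cd_conj p = cd_neg p"
proof (induction k arbitrary: p)
  case (Suc k)
  from Suc.prems show ?case by (auto simp: cd_E_Suc intro: Suc.IH)
qed (auto simp: cd_E_0)

lemma cd_E_conj_mult:
  "p \<in> cd_E k \<Longrightarrow> cd_mult \<gamma> k (cd_conj p) p = cd_mult \<gamma> k p (cd_conj p)"
  by (cases "p = cd_one k") (auto simp: cd_conj_E cd_mult_scale)

text \<open>Two elements of the first half anticommute by induction. Mixed products differ by a
  conjugation, which negates the factor from the first half. The second half is handled by
  \<open>*\<close>.\<close>

lemma cd_E_anticomm:
  assumes "p \<in> cd_E k" "q \<in> cd_E k" "p \<noteq> cd_one k" "q \<noteq> cd_one k" "p \<noteq> q"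
  shows "cd_mult \<gamma> k p q = cd_neg (cd_mult \<gamma> k q p)"
  using assms
proof (induction k arbitrary: p q)
  case 0
  then show ?case by (auto simp: cd_E_0)
next
  case (Suc k)
  \<comment> \<open>Two elements of the second half multiply through a conjugated factor. Here one
    of \<open>p\<close>, \<open>q\<close> may be the unity, which the induction hypothesis does not
    cover.\<close>
  have *: "cd_scale s (cd_mult \<gamma> k (cd_conj p) q) = cd_scale (- s) (cd_mult \<gamma> k (cd_conj q) p)"
    if "p \<in> cd_E k" "q \<in> cd_E k" "p \<noteq> q" for p q s
  proof (cases "p = cd_one k \<or> q = cd_one k")
    case True
    then show ?thesis using that by (auto simp: cd_conj_E cd_mult_scale)
  next
    case False
    then show ?thesis
      using that Suc.IH[of p q] by (auto simp: cd_conj_E cd_mult_scale)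
  qed
  show ?case
    using Suc.prems by (auto simp: cd_E_Suc cd_mult_scale cd_conj_E intro: Suc.IH *)
qed

subsection \<open>Equality up to sign\<close>

text \<open>Modulo this relation the basis multiplies like an elementary abelian 2-group, which
  makes cancellation available.\<close>

definition cd_sim :: "cd \<Rightarrow> cd \<Rightarrow> bool" where
  "cd_sim x y \<longleftrightarrow> (\<exists>s\<in>{1, -1}. x = cd_scale s y)"

lemma cd_sim_refl [simp]: "cd_sim x x"
  by (auto simp: cd_sim_def)

lemma cd_sim_sym: "cd_sim x y \<Longrightarrow> cd_sim y x"
  by (auto simp: cd_sim_def)

lemma cd_sim_trans [trans]: "cd_sim x y \<Longrightarrow> cd_sim y z \<Longrightarrow> cd_sim x z"
  by (auto simp: cd_sim_def)

lemma cd_sim_scale: "s \<in> {1, -1} \<Longrightarrow> cd_sim (cd_scale s x) x"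
  by (auto simp: cd_sim_def)

lemma cd_sim_scale_iff [simp]:
  assumes "s \<in> {1, -1}"
  shows "cd_sim (cd_scale s x) y \<longleftrightarrow> cd_sim x y" "cd_sim x (cd_scale s y) \<longleftrightarrow> cd_sim x y"
  using assms cd_sim_scale cd_sim_sym cd_sim_trans by blast+

lemma cd_sim_mult:
  assumes "x' \<in> cd_alg k" "y' \<in> cd_alg k" "cd_sim x x'" "cd_sim y y'"
  shows "cd_sim (cd_mult \<gamma> k x y) (cd_mult \<gamma> k x' y')"
  using assms by (auto simp: cd_sim_def cd_mult_scale)

lemma cd_sim_closed: "cd_sim x y \<Longrightarrow> y \<in> cd_alg k \<Longrightarrow> x \<in> cd_alg k"
  by (auto simp: cd_sim_def)

lemma cd_sim_zero_iff: "x \<in> cd_alg k \<Longrightarrow> cd_sim x (cd_zero k) \<longleftrightarrow> x = cd_zero k"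
  by (auto simp: cd_sim_def)

lemma cd_sim_Pair_zero [simp]:
  "cd_sim (CD_Pair x (cd_zero k)) (CD_Pair y (cd_zero k)) \<longleftrightarrow> cd_sim x y"
  "cd_sim (CD_Pair (cd_zero k) x) (CD_Pair (cd_zero k) y) \<longleftrightarrow> cd_sim x y"
  by (auto simp: cd_sim_def)

lemma cd_E_sim_eq: "p \<in> cd_E k \<Longrightarrow> q \<in> cd_E k \<Longrightarrow> cd_sim p q \<Longrightarrow> p = q"
  unfolding cd_sim_def using cd_E_scale_eqD by blast

lemma cd_sim_conj_E: "p \<in> cd_E k \<Longrightarrow> cd_sim (cd_conj p) p"
  by (cases "p = cd_one k") (auto simp: cd_conj_E)

lemma cd_E_comm_sim:
  assumes "p \<in> cd_E k" "q \<in> cd_E k"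
  shows "cd_sim (cd_mult \<gamma> k p q) (cd_mult \<gamma> k q p)"
proof (cases "p = cd_one k \<or> q = cd_one k \<or> p = q")
  case False
  then have "cd_mult \<gamma> k p q = cd_neg (cd_mult \<gamma> k q p)"
    using assms by (intro cd_E_anticomm) auto
  then show ?thesis by simp
qed (use assms in auto)

section \<open>Products of basis elements up to sign\<close>

locale cd_params =
  fixes \<gamma> :: "nat \<Rightarrow> real"
  assumes gamma: "\<gamma> k \<in> {1, -1}"
begin

abbreviation mul where "mul \<equiv> cd_mult \<gamma>"

lemma gamma_sq [simp]: "\<gamma> k * \<gamma> k = 1" "\<gamma> k * (\<gamma> k * x) = x"
  using gamma[of k] by auto

lemma gamma_nz [simp]: "\<gamma> k \<noteq> 0"
  using gamma[of k] by auto

text \<open>Up to sign neither the order of the factors, nor conjugation, nor the parameter matters.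
  Hence the halves add modulo 2 and the inner product is always \<open>mul k p q\<close>.\<close>

lemma E_mult_Suc_sim:
  assumes "p \<in> cd_E k" "q \<in> cd_E k"
  shows "cd_sim (mul (Suc k) (CD_Pair p (cd_zero k)) (CD_Pair q (cd_zero k)))
           (CD_Pair (mul k p q) (cd_zero k))"
    and "cd_sim (mul (Suc k) (CD_Pair p (cd_zero k)) (CD_Pair (cd_zero k) q))
           (CD_Pair (cd_zero k) (mul k p q))"
    and "cd_sim (mul (Suc k) (CD_Pair (cd_zero k) p) (CD_Pair q (cd_zero k)))
           (CD_Pair (cd_zero k) (mul k p q))"
    and "cd_sim (mul (Suc k) (CD_Pair (cd_zero k) p) (CD_Pair (cd_zero k) q))
           (CD_Pair (mul k p q) (cd_zero k))"
proof -
  have comm: "cd_sim (mul k q p) (mul k p q)"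
    using assms by (simp add: cd_E_comm_sim)
  have conj: "cd_sim (mul k p (cd_conj q)) (mul k p q)" "cd_sim (mul k (cd_conj q) p) (mul k q p)"
    using assms by (auto intro!: cd_sim_mult simp: cd_sim_conj_E)
  note cd_sim_trans[OF conj(2) comm]
  with conj(1) comm show "cd_sim (mul (Suc k) (CD_Pair p (cd_zero k)) (CD_Pair q (cd_zero k)))
           (CD_Pair (mul k p q) (cd_zero k))"
    and "cd_sim (mul (Suc k) (CD_Pair p (cd_zero k)) (CD_Pair (cd_zero k) q))
           (CD_Pair (cd_zero k) (mul k p q))"
    and "cd_sim (mul (Suc k) (CD_Pair (cd_zero k) p) (CD_Pair q (cd_zero k)))
           (CD_Pair (cd_zero k) (mul k p q))"
    and "cd_sim (mul (Suc k) (CD_Pair (cd_zero k) p) (CD_Pair (cd_zero k) q))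
           (CD_Pair (mul k p q) (cd_zero k))"
    using assms by (simp_all add: cd_sim_scale_iff[OF gamma])
qed

lemma E_mult_sim:
  assumes "p \<in> cd_E k" "q \<in> cd_E k"
  shows "\<exists>r\<in>cd_E k. cd_sim (mul k p q) r"
  using assms
proof (induction k arbitrary: p q)
  case 0
  then show ?case by (auto simp: cd_E_0)
next
  case (Suc k)
  \<comment> \<open>\<open>X\<close> stands for each of the four products in
    \<open>E_mult_Suc_sim\<close>.\<close>
  have "\<exists>r\<in>cd_E (Suc k). cd_sim X r"
    if "cd_sim X (CD_Pair (mul k p q) (cd_zero k)) \<or> cd_sim X (CD_Pair (cd_zero k) (mul k p q))"
      and pq: "p \<in> cd_E k" "q \<in> cd_E k" for X p q
  proof -
    obtain r where r: "r \<in> cd_E k" "cd_sim (mul k p q) r"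
      using Suc.IH[OF pq] by blast
    then have "cd_sim X (CD_Pair r (cd_zero k)) \<or> cd_sim X (CD_Pair (cd_zero k) r)"
      using that(1) cd_sim_trans cd_sim_Pair_zero by blast
    with r show ?thesis
      unfolding cd_E_Suc by blast
  qed
  with Suc.prems E_mult_Suc_sim show ?case
    unfolding cd_E_Suc by blast
qed

lemma E_mult_nonzero:
  assumes "p \<in> cd_E k" "q \<in> cd_E k"
  shows "mul k p q \<noteq> cd_zero k"
proof
  assume "mul k p q = cd_zero k"
  with E_mult_sim[OF assms] obtain r where "r \<in> cd_E k" "cd_sim r (cd_zero k)"
    using cd_sim_sym by metis
  then show False by (simp add: cd_sim_zero_iff)
qed

text \<open>The half of the product and the half of \<open>p\<close> determine the half of the other
  factor; within one half, cancellation holds one level down.\<close>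

lemma E_mult_cancel:
  assumes "p \<in> cd_E k" "q \<in> cd_E k" "r \<in> cd_E k" "cd_sim (mul k p q) (mul k p r)"
  shows "q = r"
  using assms
proof (induction k arbitrary: p q r)
  case 0
  then show ?case by (auto simp: cd_E_0)
next
  case (Suc k)
  have same: "q = r"
    if "p \<in> cd_E k" "q \<in> cd_E k" "r \<in> cd_E k" "cd_sim X Y"
      "cd_sim X (CD_Pair (mul k p q) (cd_zero k)) \<and> cd_sim Y (CD_Pair (mul k p r) (cd_zero k))
        \<or> cd_sim X (CD_Pair (cd_zero k) (mul k p q)) \<and> cd_sim Y (CD_Pair (cd_zero k) (mul k p r))"
    for p q r X Y
    using that Suc.IH[OF that(1-3)] cd_sim_sym cd_sim_trans cd_sim_Pair_zero by meson
  \<comment> \<open>If \<open>q\<close> and \<open>r\<close> lie in different halves, so do their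
    products with \<open>p\<close>, and these are nonzero.\<close>
  have diff: False
    if "p \<in> cd_E k" "q \<in> cd_E k" "r \<in> cd_E k" "cd_sim X Y"
      "cd_sim X (CD_Pair (mul k p q) (cd_zero k)) \<and> cd_sim Y (CD_Pair (cd_zero k) (mul k p r))
        \<or> cd_sim X (CD_Pair (cd_zero k) (mul k p q)) \<and> cd_sim Y (CD_Pair (mul k p r) (cd_zero k))"
    for p q r X Y
  proof -
    have "cd_sim (CD_Pair (mul k p q) (cd_zero k)) (CD_Pair (cd_zero k) (mul k p r))
        \<or> cd_sim (CD_Pair (cd_zero k) (mul k p q)) (CD_Pair (mul k p r) (cd_zero k))"
      using that cd_sim_sym cd_sim_trans by meson
    then show False
      using E_mult_nonzero[OF that(1,2)] that by (auto simp: cd_sim_def)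
  qed
  have split: "\<exists>x'\<in>cd_E k. x = CD_Pair x' (cd_zero k) \<or> x = CD_Pair (cd_zero k) x'"
    if "x \<in> cd_E (Suc k)" for x
    using that unfolding cd_E_Suc by blast
  obtain p' q' r' where in_E: "p' \<in> cd_E k" "q' \<in> cd_E k" "r' \<in> cd_E k"
    and eqs: "p = CD_Pair p' (cd_zero k) \<or> p = CD_Pair (cd_zero k) p'"
      "q = CD_Pair q' (cd_zero k) \<or> q = CD_Pair (cd_zero k) q'"
      "r = CD_Pair r' (cd_zero k) \<or> r = CD_Pair (cd_zero k) r'"
    using split[OF Suc.prems(1)] split[OF Suc.prems(2)] split[OF Suc.prems(3)] by blast
  show ?case
    using eqs same[OF in_E Suc.prems(4)] diff[OF in_E Suc.prems(4)]
      E_mult_Suc_sim[OF in_E(1,2)] E_mult_Suc_sim[OF in_E(1,3)]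
    by (elim disjE) (simp_all del: cd_mult.simps)
qed

subsection \<open>The operation \<open>x \<mapsto> x e\<close> with \<open>e = (0, 1)\<close>\<close>

lemma te0_Suc: "cd_te0 (Suc m) = CD_Pair (cd_zero m) (cd_one m)"
  by (simp add: cd_te0_def)

lemma te0_in_E [simp]: "cd_te0 (Suc m) \<in> cd_E (Suc m)"
  by (auto simp: te0_Suc cd_E_Suc)

text \<open>Multiplication by e exchanges the halves; only the entry moving into the first half
  picks up the parameter.\<close>

lemma tilde_Pair [simp]:
  "p \<in> cd_alg m \<Longrightarrow> q \<in> cd_alg m \<Longrightarrow>
    cd_tilde \<gamma> (Suc m) (CD_Pair p q) = CD_Pair (cd_scale (\<gamma> m) q) p"
  by (simp add: cd_tilde_def te0_Suc)

lemma tilde_closed [simp]: "x \<in> cd_alg (Suc m) \<Longrightarrow> cd_tilde \<gamma> (Suc m) x \<in> cd_alg (Suc m)"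
  by auto

lemma tilde_tilde:
  "x \<in> cd_alg (Suc m) \<Longrightarrow> cd_tilde \<gamma> (Suc m) (cd_tilde \<gamma> (Suc m) x) = cd_scale (\<gamma> m) x"
  by auto

lemma tilde_scale:
  "x \<in> cd_alg (Suc m) \<Longrightarrow>
    cd_tilde \<gamma> (Suc m) (cd_scale r x) = cd_scale r (cd_tilde \<gamma> (Suc m) x)"
  by (auto simp: mult.commute)

lemma tilde_sim:
  "x \<in> cd_alg (Suc m) \<Longrightarrow> cd_sim y x \<Longrightarrow> cd_sim (cd_tilde \<gamma> (Suc m) y) (cd_tilde \<gamma> (Suc m) x)"
  by (auto simp: cd_sim_def tilde_scale simp del: cd_alg.simps)

lemma tilde_sim_E: "a \<in> cd_E (Suc m) \<Longrightarrow> \<exists>b\<in>cd_E (Suc m). cd_sim (cd_tilde \<gamma> (Suc m) a) b"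
  unfolding cd_tilde_def by (rule E_mult_sim) auto

text \<open>Multiplying twice by e gives the scalar \<open>\<gamma> m\<close>, a sign, so the
  operation is an involution up to sign.\<close>

lemma sim_tilde_swap:
  assumes "a \<in> cd_alg (Suc m)" "b \<in> cd_alg (Suc m)" "cd_sim a (cd_tilde \<gamma> (Suc m) b)"
  shows "cd_sim b (cd_tilde \<gamma> (Suc m) a)"
proof -
  have "cd_sim (cd_tilde \<gamma> (Suc m) a) (cd_tilde \<gamma> (Suc m) (cd_tilde \<gamma> (Suc m) b))"
    using assms by (intro tilde_sim) (auto simp del: cd_alg.simps)
  then show ?thesis
    using assms by (simp add: tilde_tilde cd_sim_scale_iff[OF gamma] cd_sim_sym del: cd_alg.simps)
qed

text \<open>Only e itself is sent to a multiple of the unity; every other basis element goes, up to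
  sign, to a basis element that conjugation negates.\<close>

lemma conj_tilde:
  assumes "a \<in> cd_E (Suc m)" "a \<noteq> cd_te0 (Suc m)"
  shows "cd_conj (cd_tilde \<gamma> (Suc m) a) = cd_neg (cd_tilde \<gamma> (Suc m) a)"
proof -
  consider p where "p \<in> cd_E m" "a = CD_Pair p (cd_zero m)"
    | p where "p \<in> cd_E m" "p \<noteq> cd_one m" "a = CD_Pair (cd_zero m) p"
    using assms unfolding cd_E_Suc te0_Suc by blast
  then show ?thesis
    by cases (auto simp: cd_conj_E mult.commute)
qed

section \<open>Norms of basis elements\<close>

text \<open>The norm of (p, 0) is n(p) and that of (0, p) is \<open>- \<gamma> k\<close> times n(p),
  so only signs occur. The reversed product agrees because \<open>p\<close> commutes with its
  conjugate.\<close>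

lemma E_norm:
  assumes "p \<in> cd_E k"
  obtains \<nu> where "\<nu> \<in> {1, -1}" "mul k p (cd_conj p) = cd_scale \<nu> (cd_one k)"
    "mul k (cd_conj p) p = cd_scale \<nu> (cd_one k)"
proof -
  have "\<exists>\<nu>\<in>{1, -1}. mul k p (cd_conj p) = cd_scale \<nu> (cd_one k)"
    using assms
  proof (induction k arbitrary: p)
    case 0
    then show ?case by (auto simp: cd_E_0)
  next
    case (Suc k)
    have "\<exists>\<nu>\<in>{1, -1}. mul (Suc k) (CD_Pair q (cd_zero k)) (cd_conj (CD_Pair q (cd_zero k)))
        = cd_scale \<nu> (cd_one (Suc k))"
      and "\<exists>\<nu>\<in>{1, -1}. mul (Suc k) (CD_Pair (cd_zero k) q) (cd_conj (CD_Pair (cd_zero k) q))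
        = cd_scale \<nu> (cd_one (Suc k))"
      if q: "q \<in> cd_E k" for q
    proof -
      obtain \<nu> where \<nu>: "\<nu> \<in> {1, -1}" "mul k q (cd_conj q) = cd_scale \<nu> (cd_one k)"
        using Suc.IH[OF q] by blast
      show "\<exists>\<nu>\<in>{1, -1}. mul (Suc k) (CD_Pair q (cd_zero k)) (cd_conj (CD_Pair q (cd_zero k)))
        = cd_scale \<nu> (cd_one (Suc k))"
        using q \<nu> by (intro bexI[of _ \<nu>]) simp_all
      show "\<exists>\<nu>\<in>{1, -1}. mul (Suc k) (CD_Pair (cd_zero k) q) (cd_conj (CD_Pair (cd_zero k) q))
        = cd_scale \<nu> (cd_one (Suc k))"
        using q \<nu> gamma[of k] by (intro bexI[of _ "- \<gamma> k * \<nu>"]) (auto simp: cd_mult_scale cd_E_conj_mult)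
    qed
    with Suc.prems show ?case
      unfolding cd_E_Suc by blast
  qed
  with that cd_E_conj_mult[OF assms] show thesis by metis
qed

text \<open>The unity is nonzero, so the scalar selected by \<open>THE\<close> is unique.\<close>

lemma cd_norm_eqI: "mul k a (cd_conj a) = cd_scale \<nu> (cd_one k) \<Longrightarrow> cd_norm \<gamma> k a = \<nu>"
  unfolding cd_norm_def by (rule the_equality) (auto simp: cd_scale_inject[of _ k])

text \<open>Multiplication by e multiplies the norm by n(e) = \<open>- \<gamma> m\<close>. This is
  where the formula for \<chi> comes from.\<close>

lemma mult_conj_tilde:
  assumes "a \<in> cd_E (Suc m)" "mul (Suc m) a (cd_conj a) = cd_scale \<nu> (cd_one (Suc m))"
  shows "mul (Suc m) (cd_tilde \<gamma> (Suc m) a) (cd_conj (cd_tilde \<gamma> (Suc m) a))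
    = cd_scale (- \<gamma> m * \<nu>) (cd_one (Suc m))"
proof -
  \<comment> \<open>For \<open>a\<close> = (0, p) the hypothesis gives \<open>- \<gamma> m\<close>
    times n(p); since \<open>- \<gamma> m\<close> is its own inverse, this can be solved for
    n(p).\<close>
  have "X = cd_scale (- \<gamma> m * \<nu>) (cd_one m)"
    if "cd_scale (- \<gamma> m) X = cd_scale \<nu> (cd_one m)" for X
    using arg_cong[OF that, of "cd_scale (- \<gamma> m)"] by simp
  then show ?thesis
    using assms by (auto simp: cd_E_Suc cd_mult_scale cd_E_conj_mult)
qed

text \<open>Let \<open>p\<close> and \<open>q\<close> be the nonzero halves of \<open>a\<close> and
  \<open>b\<close>. The hypotheses make them distinct and different from the unity, so they
  anticommute and conjugation negates both. The four positions are then direct computations.\<close>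

lemma tilde_mult_tilde:
  assumes "a \<in> cd_E'' (Suc m)" "b \<in> cd_E'' (Suc m)" "b \<noteq> a"
    "\<not> cd_sim b (cd_tilde \<gamma> (Suc m) a)"
  shows "mul (Suc m) (cd_tilde \<gamma> (Suc m) a) (cd_tilde \<gamma> (Suc m) b)
      = cd_scale (- \<gamma> m) (mul (Suc m) b a)"
    and "mul (Suc m) b (cd_tilde \<gamma> (Suc m) a) = cd_neg (mul (Suc m) a (cd_tilde \<gamma> (Suc m) b))"
proof -
  have anti: "mul m p q = cd_neg (mul m q p)"
    if "p \<in> cd_E m" "q \<in> cd_E m" "p \<noteq> cd_one m" "q \<noteq> cd_one m" "p \<noteq> q" for p q
    using that by (rule cd_E_anticomm)
  have a: "a \<in> cd_E (Suc m)" "a \<noteq> CD_Pair (cd_one m) (cd_zero m)" "a \<noteq> CD_Pair (cd_zero m) (cd_one m)"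
    and b: "b \<in> cd_E (Suc m)" "b \<noteq> CD_Pair (cd_one m) (cd_zero m)" "b \<noteq> CD_Pair (cd_zero m) (cd_one m)"
    using assms by (auto simp: cd_E''_def te0_Suc)
  obtain p where p: "p \<in> cd_E m" "p \<noteq> cd_one m"
    and "a = CD_Pair p (cd_zero m) \<or> a = CD_Pair (cd_zero m) p"
    using a unfolding cd_E_Suc by blast
  moreover obtain q where q: "q \<in> cd_E m" "q \<noteq> cd_one m"
    and "b = CD_Pair q (cd_zero m) \<or> b = CD_Pair (cd_zero m) q"
    using b unfolding cd_E_Suc by blast
  \<comment> \<open>If \<open>p = q\<close>, then \<open>b\<close> is \<open>a\<close> or, up to
    sign, ae.\<close>
  moreover have "p \<noteq> q"
    using assms(3,4) calculation by (auto simp: cd_sim_scale_iff[OF gamma])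
  ultimately show "mul (Suc m) (cd_tilde \<gamma> (Suc m) a) (cd_tilde \<gamma> (Suc m) b)
      = cd_scale (- \<gamma> m) (mul (Suc m) b a)"
    and "mul (Suc m) b (cd_tilde \<gamma> (Suc m) a) = cd_neg (mul (Suc m) a (cd_tilde \<gamma> (Suc m) b))"
    using anti[of p q] by (auto simp: cd_conj_E cd_mult_scale)
qed

text \<open>A version up to sign without exceptional pairs: exchanging the halves of both factors
  changes neither the half of the product nor its inner product.\<close>

lemma tilde_mult_tilde_sim:
  assumes "a \<in> cd_E (Suc m)" "b \<in> cd_E (Suc m)"
  shows "cd_sim (mul (Suc m) (cd_tilde \<gamma> (Suc m) a) (cd_tilde \<gamma> (Suc m) b)) (mul (Suc m) b a)"
proof -
  obtain p where p: "p \<in> cd_E m" and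
    a: "a = CD_Pair p (cd_zero m) \<and> cd_sim (cd_tilde \<gamma> (Suc m) a) (CD_Pair (cd_zero m) p)
      \<or> a = CD_Pair (cd_zero m) p \<and> cd_sim (cd_tilde \<gamma> (Suc m) a) (CD_Pair p (cd_zero m))"
    using assms(1) unfolding cd_E_Suc by (auto simp: cd_sim_scale_iff[OF gamma])
  obtain q where q: "q \<in> cd_E m" and
    b: "b = CD_Pair q (cd_zero m) \<and> cd_sim (cd_tilde \<gamma> (Suc m) b) (CD_Pair (cd_zero m) q)
      \<or> b = CD_Pair (cd_zero m) q \<and> cd_sim (cd_tilde \<gamma> (Suc m) b) (CD_Pair q (cd_zero m))"
    using assms(2) unfolding cd_E_Suc by (auto simp: cd_sim_scale_iff[OF gamma])
  have "cd_sim (mul (Suc m) (cd_tilde \<gamma> (Suc m) a) (cd_tilde \<gamma> (Suc m) b)) (mul (Suc m) x y)"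
    if "cd_sim (cd_tilde \<gamma> (Suc m) a) x" "cd_sim (cd_tilde \<gamma> (Suc m) b) y"
      "x \<in> {CD_Pair p (cd_zero m), CD_Pair (cd_zero m) p}"
      "y \<in> {CD_Pair q (cd_zero m), CD_Pair (cd_zero m) q}" for x y
    using that p q by (intro cd_sim_mult) auto
  note prod = cd_sim_trans[OF this E_mult_Suc_sim(1)[OF p q]] cd_sim_trans[OF this E_mult_Suc_sim(2)[OF p q]]
    cd_sim_trans[OF this E_mult_Suc_sim(3)[OF p q]] cd_sim_trans[OF this E_mult_Suc_sim(4)[OF p q]]
  \<comment> \<open>\<open>Z\<close> is \<open>mul m p q\<close> placed in the half determined by
    the positions of \<open>a\<close> and \<open>b\<close>.\<close>
  have "\<exists>Z. cd_sim (mul (Suc m) (cd_tilde \<gamma> (Suc m) a) (cd_tilde \<gamma> (Suc m) b)) Z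
      \<and> cd_sim (mul (Suc m) a b) Z"
    using a b
  proof (elim disjE conjE, goal_cases)
    case 1
    then show ?case using prod(4) E_mult_Suc_sim(1)[OF p q] by blast
  next
    case 2
    then show ?case using prod(3) E_mult_Suc_sim(2)[OF p q] by blast
  next
    case 3
    then show ?case using prod(2) E_mult_Suc_sim(3)[OF p q] by blast
  next
    case 4
    then show ?case using prod(1) E_mult_Suc_sim(4)[OF p q] by blast
  qed
  then have "cd_sim (mul (Suc m) (cd_tilde \<gamma> (Suc m) a) (cd_tilde \<gamma> (Suc m) b)) (mul (Suc m) a b)"
    using cd_sim_sym cd_sim_trans by blast
  also have "cd_sim (mul (Suc m) a b) (mul (Suc m) b a)"
    using assms by (rule cd_E_comm_sim)
  finally show ?thesis .
qed

subsection \<open>Products of pairs \<open>(x e, \<plusminus>x)\<close>\<close>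

text \<open>For \<open>r = \<epsilon>\<close> and \<open>x = a\<close> this is the element of the
  theorem; for \<chi> = -1 all its neighbours have this shape with
  \<open>r = - \<epsilon>\<close>.\<close>

definition twist :: "nat \<Rightarrow> real \<Rightarrow> cd \<Rightarrow> cd" where
  "twist n r x = CD_Pair (cd_tilde \<gamma> n x) (cd_scale r x)"

lemma twist_closed [simp]: "x \<in> cd_alg (Suc m) \<Longrightarrow> twist (Suc m) r x \<in> cd_alg (Suc (Suc m))"
  unfolding twist_def cd_alg.simps(2)[of "Suc m"] using tilde_closed cd_scale_closed by blast

lemma scale_twist: "cd_scale s (twist n r x) = CD_Pair (cd_scale s (cd_tilde \<gamma> n x)) (cd_scale (s * r) x)"
  by (simp add: twist_def)

lemma twist_mult:
  assumes "a \<in> cd_alg (Suc m)" "c \<in> cd_alg (Suc m)" "d \<in> cd_alg (Suc m)"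
  shows "mul (Suc (Suc m)) (twist (Suc m) \<epsilon> a) (CD_Pair c d) =
    CD_Pair (cd_add (mul (Suc m) (cd_tilde \<gamma> (Suc m) a) c)
                    (cd_scale (\<gamma> (Suc m) * \<epsilon>) (mul (Suc m) (cd_conj d) a)))
            (cd_add (mul (Suc m) d (cd_tilde \<gamma> (Suc m) a))
                    (cd_scale \<epsilon> (mul (Suc m) a (cd_conj c))))"
  using assms by (simp add: twist_def cd_mult_scale del: cd_alg.simps)

text \<open>By \<open>tilde_mult_tilde\<close> the two terms of each component are multiples of the
  same product, so that vanishing becomes a question about two scalars.\<close>

lemma twist_mult_twist:
  assumes "a \<in> cd_E'' (Suc m)" "b \<in> cd_E'' (Suc m)" "b \<noteq> a"
    "\<not> cd_sim b (cd_tilde \<gamma> (Suc m) a)"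
  shows "mul (Suc (Suc m)) (twist (Suc m) \<epsilon> a) (twist (Suc m) \<delta> b) =
    CD_Pair (cd_scale (- (\<gamma> m + \<gamma> (Suc m) * \<epsilon> * \<delta>)) (mul (Suc m) b a))
            (cd_scale (\<delta> + \<epsilon>) (mul (Suc m) b (cd_tilde \<gamma> (Suc m) a)))"
proof -
  have E: "a \<in> cd_E (Suc m)" "b \<in> cd_E (Suc m)" "a \<noteq> cd_te0 (Suc m)" "b \<noteq> cd_te0 (Suc m)"
    "b \<noteq> cd_one (Suc m)"
    using assms by (auto simp: cd_E''_def)
  then have closed: "a \<in> cd_alg (Suc m)" "b \<in> cd_alg (Suc m)"
    by (simp_all del: cd_alg.simps)
  have swap: "mul (Suc m) a (cd_tilde \<gamma> (Suc m) b) = cd_neg (mul (Suc m) b (cd_tilde \<gamma> (Suc m) a))"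
    by (simp only: tilde_mult_tilde(2)[OF assms] cd_scale_scale) simp
  have "mul (Suc (Suc m)) (twist (Suc m) \<epsilon> a) (twist (Suc m) \<delta> b) =
    CD_Pair (cd_add (cd_scale (- \<gamma> m) (mul (Suc m) b a))
                    (cd_scale (\<gamma> (Suc m) * \<epsilon> * - \<delta>) (mul (Suc m) b a)))
            (cd_add (cd_scale \<delta> (mul (Suc m) b (cd_tilde \<gamma> (Suc m) a)))
                    (cd_scale \<epsilon> (mul (Suc m) b (cd_tilde \<gamma> (Suc m) a))))"
    unfolding twist_def[of _ \<delta>]
    using closed E
    by (simp add: twist_mult tilde_mult_tilde(1)[OF assms] swap cd_conj_E conj_tilde cd_mult_scale
        del: cd_alg.simps cd_mult.simps cd_basis.simps)
  then show ?thesis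
    by (simp add: cd_add_scale)
qed

subsection \<open>Orthogonality and zero divisors\<close>

text \<open>With opposite signs and equal parameters both scalars of \<open>twist_mult_twist\<close>
  vanish.\<close>

lemma orth_twist_twist:
  assumes "a \<in> cd_E'' (Suc m)" "b \<in> cd_E'' (Suc m)" "b \<noteq> a"
    "\<not> cd_sim b (cd_tilde \<gamma> (Suc m) a)"
    and "\<gamma> (Suc m) = \<gamma> m" "\<epsilon> \<in> {1, -1}"
  shows "cd_orth \<gamma> (Suc (Suc m)) (twist (Suc m) \<epsilon> a) (twist (Suc m) (- \<epsilon>) b)"
proof -
  have closed: "a \<in> cd_alg (Suc m)" "b \<in> cd_alg (Suc m)"
    using assms by (auto simp: cd_E''_def simp del: cd_alg.simps)
  \<comment> \<open>The condition is symmetric in \<open>a\<close> and \<open>b\<close>, which gives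
    the product in the other order.\<close>
  have "\<not> cd_sim a (cd_tilde \<gamma> (Suc m) b)"
    using assms(4) sim_tilde_swap closed by blast
  moreover have "\<epsilon> * \<epsilon> = 1"
    using assms(6) by auto
  ultimately show ?thesis
    using assms closed
    by (simp add: cd_orth_def twist_mult_twist mult.assoc cd_zero.simps(2)[of "Suc m"]
        del: cd_alg.simps cd_zero.simps cd_mult.simps insert_iff)
qed

text \<open>For \<open>b\<close> equal to the unity or to ae up to sign, the two components impose
  incompatible signs; a generic \<open>b\<close> forces \<open>\<delta> = - \<epsilon>\<close>. For
  \<open>b = a\<close> only the second component is used: the alternative left is the element
  itself, which adjacency excludes later.\<close>

lemma twist_mult_twist_eq_zeroD:
  assumes a: "a \<in> cd_E'' (Suc m)" and b: "b \<in> cd_E (Suc m)" "b \<noteq> cd_te0 (Suc m)"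
    and g: "\<gamma> (Suc m) = \<gamma> m" and signs: "\<epsilon> \<in> {1, -1}" "\<delta> \<in> {1, -1}"
    and zero: "mul (Suc (Suc m)) (twist (Suc m) \<epsilon> a) (twist (Suc m) \<delta> b) = cd_zero (Suc (Suc m))"
  shows "b = a \<and> \<delta> = \<epsilon>
    \<or> b \<in> cd_E'' (Suc m) \<and> b \<noteq> a \<and> \<not> cd_sim b (cd_tilde \<gamma> (Suc m) a) \<and> \<delta> = - \<epsilon>"
proof -
  let ?k = "Suc m" and ?t = "cd_tilde \<gamma> (Suc m)"
  note [simp del] = cd_alg.simps cd_zero.simps cd_mult.simps cd_basis.simps
  have aE: "a \<in> cd_E ?k" "a \<noteq> cd_one ?k" "a \<noteq> cd_te0 ?k"
    using a by (auto simp: cd_E''_def)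
  then have closed: "a \<in> cd_alg ?k" "b \<in> cd_alg ?k"
    using b by simp_all
  have "CD_Pair (cd_add (mul ?k (?t a) (?t b))
                    (cd_scale (\<gamma> ?k * \<epsilon>) (mul ?k (cd_conj (cd_scale \<delta> b)) a)))
            (cd_add (mul ?k (cd_scale \<delta> b) (?t a))
                    (cd_scale \<epsilon> (mul ?k a (cd_conj (?t b))))) = cd_zero (Suc ?k)"
    using zero closed unfolding twist_def[of _ \<delta>] by (simp add: twist_mult)
  then have fst0: "cd_add (mul ?k (?t a) (?t b)) (cd_scale (\<gamma> m * \<epsilon> * \<delta>) (mul ?k (cd_conj b) a))
      = cd_zero ?k"
    and snd0: "cd_add (cd_scale \<delta> (mul ?k b (?t a))) (cd_scale (- \<epsilon>) (mul ?k a (?t b))) = cd_zero ?k"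
    using closed b by (simp_all add: cd_zero.simps(2) cd_mult_scale conj_tilde g)
  obtain a' where a': "a' \<in> cd_E ?k" "cd_sim (?t a) a'"
    using tilde_sim_E aE by blast
  \<comment> \<open>\<open>?t a\<close> is a basis element only up to sign, so nonvanishing is
    transferred from \<open>a'\<close>.\<close>
  have mult_nz: "mul ?k x (?t a) \<noteq> cd_zero ?k" if "x \<in> cd_E ?k" for x
  proof
    assume "mul ?k x (?t a) = cd_zero ?k"
    then have "cd_sim (mul ?k x a') (cd_zero ?k)"
      using cd_sim_mult[of x ?k "?t a" x a' \<gamma>] a' that closed cd_sim_sym by auto
    then show False
      using E_mult_nonzero[OF that a'(1)] a' that by (simp add: cd_sim_zero_iff)
  qed
  obtain \<nu> where \<nu>: "\<nu> \<in> {1, -1}" "mul ?k a (cd_conj a) = cd_scale \<nu> (cd_one ?k)"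
    using E_norm aE(1) by metis
  \<comment> \<open>Conjugation negates \<open>?t a\<close>, so its square is the negative of its
    norm.\<close>
  have tt: "mul ?k (?t a) (?t a) = cd_scale (\<gamma> m * \<nu>) (cd_one ?k)"
    using arg_cong[OF mult_conj_tilde[OF aE(1) \<nu>(2)], of cd_neg] aE closed by (simp add: conj_tilde cd_mult_scale)
  consider "b = cd_one ?k" | "b = a" | "b \<noteq> cd_one ?k" "cd_sim b (?t a)"
    | "b \<noteq> cd_one ?k" "b \<noteq> a" "\<not> cd_sim b (?t a)"
    by blast
  then show ?thesis
  proof cases
    \<comment> \<open>The second component gives \<open>\<delta> = \<epsilon>\<close>, the first
      \<open>\<epsilon> * \<delta> = - 1\<close>.\<close>
    case 1
    have "?t b = cd_te0 ?k"
      using 1 by (simp add: cd_tilde_def)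
    moreover from this have "mul ?k a (?t b) = ?t a" "mul ?k (?t a) (?t b) = cd_scale (\<gamma> m) a"
      using closed tilde_tilde[of a m] by (simp_all add: cd_tilde_def)
    ultimately have "cd_scale (\<delta> - \<epsilon>) (?t a) = cd_zero ?k"
      and "cd_scale (\<gamma> m + \<gamma> m * \<epsilon> * \<delta>) a = cd_zero ?k"
      using fst0 snd0 closed by (simp_all add: 1 cd_add_scale)
    then have "\<delta> = \<epsilon>" "\<gamma> m + \<gamma> m * \<epsilon> * \<delta> = 0"
      using closed aE mult_nz[of "cd_one ?k"] by (simp_all add: cd_scale_eq_zero_iff)
    then show ?thesis
      using signs by auto
  next
    case 2
    then have "cd_scale (\<delta> - \<epsilon>) (mul ?k a (?t a)) = cd_zero ?k"
      using snd0 by (simp add: cd_add_scale)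
    then show ?thesis
      using 2 mult_nz[OF aE(1)] closed by (simp add: cd_scale_eq_zero_iff)
  next
    \<comment> \<open>The first component gives \<open>\<delta> = \<epsilon>\<close>, the second
      \<open>\<delta> = - \<epsilon>\<close>.\<close>
    case 3
    obtain s where s: "s \<in> {1, -1}" "b = cd_scale s (?t a)"
      using 3 unfolding cd_sim_def by blast
    then have ta: "?t a = cd_scale s b" and tb: "?t b = cd_scale (s * \<gamma> m) a"
      using closed by (auto simp: tilde_scale tilde_tilde)
    have aa: "mul ?k a a = cd_scale (- \<nu>) (cd_one ?k)"
      using arg_cong[OF \<nu>(2), of cd_neg] aE closed by (simp add: cd_conj_E cd_mult_scale)
    have "mul ?k (?t a) (?t b) = cd_scale (\<gamma> m) (mul ?k b a)"
      unfolding ta tb using closed s(1) by (auto simp: cd_mult_scale)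
    then have "cd_scale (\<gamma> m - \<gamma> m * \<epsilon> * \<delta>) (mul ?k b a) = cd_zero ?k"
      using fst0 closed b 3 by (simp add: cd_conj_E cd_mult_scale cd_add_scale)
    then have "\<gamma> m - \<gamma> m * \<epsilon> * \<delta> = 0"
      using E_mult_nonzero[OF b(1) aE(1)] closed by (simp add: cd_scale_eq_zero_iff)
    then have "\<delta> = \<epsilon>"
      using signs by auto
    have "mul ?k b (?t a) = cd_scale (s * \<gamma> m * \<nu>) (cd_one ?k)"
      unfolding s(2) using closed tt by (simp add: cd_mult_scale mult_ac)
    moreover have "mul ?k a (?t b) = cd_scale (- s * \<gamma> m * \<nu>) (cd_one ?k)"
      unfolding tb using closed aa by (simp add: cd_mult_scale mult_ac)
    ultimately have "cd_scale (\<delta> * (s * \<gamma> m * \<nu>) + \<epsilon> * (s * \<gamma> m * \<nu>)) (cd_one ?k) = cd_zero ?k"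
      using snd0 by (simp add: cd_add_scale)
    then have "\<delta> * (s * \<gamma> m * \<nu>) + \<epsilon> * (s * \<gamma> m * \<nu>) = 0"
      by (simp add: cd_scale_eq_zero_iff[of _ ?k])
    then have False
      using \<open>\<delta> = \<epsilon>\<close> s(1) \<nu>(1) signs by auto
    then show ?thesis ..
  next
    case 4
    have b'': "b \<in> cd_E'' ?k"
      using b 4 by (simp add: cd_E''_def)
    have "cd_scale (\<delta> + \<epsilon>) (mul ?k b (?t a)) = cd_zero ?k"
      using zero unfolding twist_mult_twist[OF a b'' 4(2,3)] by (simp add: cd_zero.simps)
    then have "\<delta> = - \<epsilon>"
      using mult_nz[OF b(1)] closed by (simp add: cd_scale_eq_zero_iff add_eq_0_iff2)
    then show ?thesis
      using b'' 4 by blast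
  qed
qed

lemma E''_diff_iff:
  "b \<in> cd_E'' (Suc m) - {a, cd_tilde \<gamma> (Suc m) a, cd_neg (cd_tilde \<gamma> (Suc m) a)}
    \<longleftrightarrow> b \<in> cd_E'' (Suc m) \<and> b \<noteq> a \<and> \<not> cd_sim b (cd_tilde \<gamma> (Suc m) a)"
  by (auto simp: cd_sim_def)

lemma twist_nonzero: "x \<in> cd_E (Suc m) \<Longrightarrow> r \<noteq> 0 \<Longrightarrow> twist (Suc m) r x \<noteq> cd_zero (Suc (Suc m))"
  by (simp add: twist_def cd_zero.simps(2)[of "Suc m"] cd_scale_eq_zero_iff[of _ "Suc m"]
      del: cd_zero.simps cd_alg.simps)

text \<open>Each of the two elements annihilates the other.\<close>

lemma twist_zero_divisor:
  assumes "a \<in> cd_E'' (Suc m)" "b \<in> cd_E'' (Suc m)" "b \<noteq> a"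
    "\<not> cd_sim b (cd_tilde \<gamma> (Suc m) a)"
    and "\<gamma> (Suc m) = \<gamma> m" "\<epsilon> \<in> {1, -1}"
  shows "cd_zero_divisor \<gamma> (Suc (Suc m)) (twist (Suc m) \<epsilon> a)"
    and "cd_zero_divisor \<gamma> (Suc (Suc m)) (twist (Suc m) (- \<epsilon>) b)"
proof -
  note [simp del] = cd_alg.simps cd_zero.simps cd_mult.simps cd_basis.simps
  have E: "a \<in> cd_E (Suc m)" "b \<in> cd_E (Suc m)"
    using assms by (auto simp: cd_E''_def)
  moreover have "\<epsilon> \<noteq> 0"
    using assms(6) by auto
  ultimately have props: "twist (Suc m) \<epsilon> a \<in> cd_alg (Suc (Suc m))"
    "twist (Suc m) (- \<epsilon>) b \<in> cd_alg (Suc (Suc m))"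
    "twist (Suc m) \<epsilon> a \<noteq> cd_zero (Suc (Suc m))"
    "twist (Suc m) (- \<epsilon>) b \<noteq> cd_zero (Suc (Suc m))"
    by (simp_all add: twist_nonzero)
  then show "cd_zero_divisor \<gamma> (Suc (Suc m)) (twist (Suc m) \<epsilon> a)"
    and "cd_zero_divisor \<gamma> (Suc (Suc m)) (twist (Suc m) (- \<epsilon>) b)"
    using orth_twist_twist[OF assms] unfolding cd_zero_divisor_def cd_orth_def by blast+
qed

section \<open>Vertices and adjacency of the graph\<close>

lemma zero_divisor_scale:
  assumes "s \<noteq> 0" "cd_zero_divisor \<gamma> k x"
  shows "cd_zero_divisor \<gamma> k (cd_scale s x)"
  using assms unfolding cd_zero_divisor_def by (auto simp: cd_mult_scale cd_scale_eq_zero_iff)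

text \<open>\<open>cd_Ze'\<close> wants a basis element as first component, whereas ae is one only
  up to sign; \<open>s\<close> is the sign that repairs this.\<close>

lemma twist_scale_in_Ze':
  assumes "a \<in> cd_E'' (Suc m)" "\<epsilon> \<in> {1, -1}" "cd_zero_divisor \<gamma> (Suc (Suc m)) (twist (Suc m) \<epsilon> a)"
  obtains s where "s \<in> {1, -1}" "cd_scale s (twist (Suc m) \<epsilon> a) \<in> cd_Ze' \<gamma> (Suc m)"
proof -
  note [simp del] = cd_alg.simps cd_zero.simps cd_mult.simps cd_basis.simps
  have aE: "a \<in> cd_E (Suc m)" "a \<noteq> cd_te0 (Suc m)"
    using assms by (auto simp: cd_E''_def)
  then obtain a' where a': "a' \<in> cd_E (Suc m)" "cd_sim (cd_tilde \<gamma> (Suc m) a) a'"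
    using tilde_sim_E by blast
  then obtain s where s: "s \<in> {1, -1}" "a' = cd_scale s (cd_tilde \<gamma> (Suc m) a)"
    using cd_sim_sym cd_sim_def by metis
  \<comment> \<open>Otherwise one more multiplication by e would make \<open>a\<close> equal to e up
    to sign.\<close>
  have "a' \<noteq> cd_one (Suc m)"
  proof
    assume one: "a' = cd_one (Suc m)"
    have "cd_sim a (cd_tilde \<gamma> (Suc m) a')"
      using sim_tilde_swap[of a' m a] a' aE cd_sim_sym by auto
    then have "cd_sim a (cd_te0 (Suc m))"
      by (simp add: one cd_tilde_def)
    then show False
      using aE cd_E_sim_eq te0_in_E by blast
  qed
  then have "a' \<in> cd_E' (Suc m)"
    using a' by (simp add: cd_E'_def)
  moreover have "cd_scale (s * \<epsilon>) a \<in> cd_E (Suc m) \<union> cd_neg ` cd_E (Suc m)"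
    using s assms(2) aE by auto
  moreover have "cd_zero_divisor \<gamma> (Suc (Suc m)) (CD_Pair a' (cd_scale (s * \<epsilon>) a))"
    using zero_divisor_scale[OF _ assms(3), of s] s by (auto simp: scale_twist)
  ultimately have "CD_Pair a' (cd_scale (s * \<epsilon>) a) \<in> cd_Ze' \<gamma> (Suc m)"
    unfolding cd_Ze'_def by blast
  then show thesis
    using that[of s] s by (simp add: scale_twist)
qed

lemma twist_line_in_verts:
  assumes "a \<in> cd_E'' (Suc m)" "\<epsilon> \<in> {1, -1}" "cd_zero_divisor \<gamma> (Suc (Suc m)) (twist (Suc m) \<epsilon> a)"
  shows "cd_line (twist (Suc m) \<epsilon> a) \<in> Gamma_e_verts \<gamma> (Suc m)"
proof -
  obtain s where "s \<in> {1, -1}" "cd_scale s (twist (Suc m) \<epsilon> a) \<in> cd_Ze' \<gamma> (Suc m)"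
    using twist_scale_in_Ze'[OF assms] .
  moreover from this(1) have "cd_line (cd_scale s (twist (Suc m) \<epsilon> a)) = cd_line (twist (Suc m) \<epsilon> a)"
    by (intro cd_line_scale) auto
  ultimately show ?thesis
    unfolding Gamma_e_verts_def by (metis imageI)
qed

text \<open>The first component of the product suffices: it says that (ae)c and da agree up to sign.
  Writing c as c'e up to sign turns (ae)c into c'a, and cancelling \<open>a\<close> gives c' = d up
  to sign.\<close>

lemma Ze'_twist:
  assumes "CD_Pair c d \<in> cd_Ze' \<gamma> (Suc m)" and a: "a \<in> cd_E'' (Suc m)" and signs: "\<epsilon> \<in> {1, -1}"
    and g: "\<gamma> (Suc m) = \<gamma> m"
    and zero: "mul (Suc (Suc m)) (twist (Suc m) \<epsilon> a) (CD_Pair c d) = cd_zero (Suc (Suc m))"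
  obtains s b \<delta> where "s \<in> {1, -1}" "CD_Pair c d = cd_scale s (twist (Suc m) \<delta> b)"
    "b \<in> cd_E (Suc m)" "b \<noteq> cd_te0 (Suc m)" "\<delta> \<in> {1, -1}"
proof -
  let ?k = "Suc m" and ?t = "cd_tilde \<gamma> (Suc m)"
  note [simp del] = cd_alg.simps cd_zero.simps cd_mult.simps cd_basis.simps
  have aE: "a \<in> cd_E ?k"
    using a by (auto simp: cd_E''_def)
  have c: "c \<in> cd_E ?k" "c \<noteq> cd_one ?k" and "d \<in> cd_E ?k \<union> cd_neg ` cd_E ?k"
    using assms(1) by (auto simp: cd_Ze'_def cd_E'_def)
  then obtain b where b: "b \<in> cd_E ?k" "cd_sim d b"
    by (auto simp: cd_sim_def)
  have closed: "a \<in> cd_alg ?k" "b \<in> cd_alg ?k" "c \<in> cd_alg ?k" "d \<in> cd_alg ?k"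
    using aE b c cd_sim_closed by simp_all
  obtain c' where c': "c' \<in> cd_E ?k" "cd_sim (?t c) c'"
    using tilde_sim_E c by blast
  then have ct: "cd_sim c (?t c')"
    using sim_tilde_swap[of c' m c] closed cd_sim_sym by simp
  have "cd_add (mul ?k (?t a) c) (cd_scale (\<gamma> ?k * \<epsilon>) (mul ?k (cd_conj d) a)) = cd_zero ?k"
    using zero closed by (simp add: twist_mult cd_zero.simps)
  then have "mul ?k (?t a) c = cd_scale (- (\<gamma> ?k * \<epsilon>)) (mul ?k (cd_conj d) a)"
    using closed by (auto dest!: cd_add_eq_zeroD[rotated 2])
  moreover have "- (\<gamma> ?k * \<epsilon>) \<in> {1, -1}"
    using gamma[of ?k] signs by auto
  ultimately have "cd_sim (mul ?k (?t a) c) (mul ?k (cd_conj d) a)"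
    using cd_sim_scale by metis
  also have "cd_sim (mul ?k (cd_conj d) a) (mul ?k b a)"
  proof -
    have "cd_sim (cd_conj d) (cd_conj b)"
      using b by (auto simp: cd_sim_def)
    also have "cd_sim (cd_conj b) b"
      using b by (simp add: cd_sim_conj_E)
    finally show ?thesis
      using closed by (intro cd_sim_mult) auto
  qed
  also have "cd_sim (mul ?k b a) (mul ?k a b)"
    using aE b by (simp add: cd_E_comm_sim)
  finally have 1: "cd_sim (mul ?k (?t a) c) (mul ?k a b)" .
  have "cd_sim (mul ?k (?t a) c) (mul ?k (?t a) (?t c'))"
    using ct closed c' by (intro cd_sim_mult) auto
  also have "cd_sim (mul ?k (?t a) (?t c')) (mul ?k c' a)"
    using aE c' by (simp add: tilde_mult_tilde_sim)
  also have "cd_sim (mul ?k c' a) (mul ?k a c')"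
    using aE c' by (simp add: cd_E_comm_sim)
  finally have "cd_sim (mul ?k a b) (mul ?k a c')"
    using 1 cd_sim_sym cd_sim_trans by blast
  then have "c' = b"
    using E_mult_cancel aE b c' by metis
  with ct obtain s where s: "s \<in> {1, -1}" "c = cd_scale s (?t b)"
    unfolding cd_sim_def by blast
  obtain r where r: "r \<in> {1, -1}" "d = cd_scale r b"
    using b unfolding cd_sim_def by blast
  \<comment> \<open>For \<open>b\<close> = e the product be is \<open>\<gamma> m\<close> times the
    unity, but \<open>c\<close> is not the unity.\<close>
  have "b \<noteq> cd_te0 ?k"
  proof
    assume "b = cd_te0 ?k"
    then have "?t b = cd_scale (\<gamma> m) (cd_one ?k)"
      using tilde_tilde[of "cd_one ?k" m] by (simp add: cd_tilde_def)
    then have "cd_sim c (cd_one ?k)"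
      using s gamma[of m] by (auto simp: cd_sim_def)
    then show False
      using c cd_E_sim_eq cd_one_in_E by blast
  qed
  moreover have "CD_Pair c d = cd_scale s (twist ?k (s * r) b)"
    using s r by (auto simp: scale_twist)
  moreover have "s * r \<in> {1, -1}"
    using s r by auto
  ultimately show thesis
    using that s(1) b(1) by blast
qed

text \<open>\<open>Ze'_twist\<close> brings any neighbour into twisted form and
  \<open>twist_mult_twist_eq_zeroD\<close> fixes its sign; distinctness of the lines removes
  \<open>b = a\<close>. The converse is \<open>orth_twist_twist\<close>.\<close>

lemma twist_line_adj_iff:
  assumes a: "a \<in> cd_E'' (Suc m)" and signs: "\<epsilon> \<in> {1, -1}" and g: "\<gamma> (Suc m) = \<gamma> m"
  shows "Gamma_e_adj \<gamma> (Suc m) (cd_line (twist (Suc m) \<epsilon> a)) L \<longleftrightarrow>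
    (\<exists>b \<in> cd_E'' (Suc m) - {a, cd_tilde \<gamma> (Suc m) a, cd_neg (cd_tilde \<gamma> (Suc m) a)}.
      L = cd_line (twist (Suc m) (- \<epsilon>) b))" (is "?adj \<longleftrightarrow> ?ex")
proof
  note [simp del] = cd_alg.simps cd_zero.simps cd_mult.simps cd_basis.simps
  have aE: "a \<in> cd_E (Suc m)"
    using a by (auto simp: cd_E''_def)
  {
    assume ?adj
    then obtain v where v: "v \<in> cd_Ze' \<gamma> (Suc m)" "L = cd_line v"
      and neq: "cd_line (twist (Suc m) \<epsilon> a) \<noteq> L"
      and orth: "cd_orth \<gamma> (Suc (Suc m)) (twist (Suc m) \<epsilon> a) v"
      unfolding Gamma_e_adj_def Gamma_e_verts_def using cd_line_self by blast
    obtain c d where cd: "v = CD_Pair c d"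
      using v by (auto simp: cd_Ze'_def)
    have "mul (Suc (Suc m)) (twist (Suc m) \<epsilon> a) (CD_Pair c d) = cd_zero (Suc (Suc m))"
      using orth cd by (simp add: cd_orth_def)
    then obtain s b \<delta> where s: "s \<in> {1, -1}" "v = cd_scale s (twist (Suc m) \<delta> b)"
      and b: "b \<in> cd_E (Suc m)" "b \<noteq> cd_te0 (Suc m)" and \<delta>: "\<delta> \<in> {1, -1}"
      using Ze'_twist[OF v(1)[unfolded cd] a signs g] cd by metis
    have s0: "s \<noteq> 0"
      using s by auto
    then have L: "L = cd_line (twist (Suc m) \<delta> b)"
      using v s by (simp add: cd_line_scale)
    have "mul (Suc (Suc m)) (twist (Suc m) \<epsilon> a) (twist (Suc m) \<delta> b) = cd_zero (Suc (Suc m))"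
      using orth aE b s0 by (simp add: cd_orth_def s(2) cd_mult_scale cd_scale_eq_zero_iff)
    from twist_mult_twist_eq_zeroD[OF a b g signs \<delta> this] neq L show ?ex
      using E''_diff_iff by metis
  next
    assume ?ex
    then obtain b where b: "b \<in> cd_E'' (Suc m)" "b \<noteq> a" "\<not> cd_sim b (cd_tilde \<gamma> (Suc m) a)"
      and L: "L = cd_line (twist (Suc m) (- \<epsilon>) b)"
      using E''_diff_iff by blast
    have bE: "b \<in> cd_E (Suc m)"
      using b by (auto simp: cd_E''_def)
    have signs': "- \<epsilon> \<in> {1, -1}"
      using signs by auto
    note zd = twist_zero_divisor[OF a b g signs]
    have "cd_line (twist (Suc m) \<epsilon> a) \<noteq> L"
    proof
      assume "cd_line (twist (Suc m) \<epsilon> a) = L"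
      then obtain r where "twist (Suc m) \<epsilon> a = cd_scale r (twist (Suc m) (- \<epsilon>) b)"
        using cd_line_self[of "twist (Suc m) \<epsilon> a"] by (auto simp: L cd_line_def)
      then have eq: "cd_scale \<epsilon> a = cd_scale (r * - \<epsilon>) b"
        by (simp add: twist_def)
      \<comment> \<open>Multiply the second components by \<epsilon>, whose square is 1.\<close>
      have "a = cd_scale (- r) b"
        using signs arg_cong[OF eq, of "cd_scale \<epsilon>"] by auto
      from cd_E_scale_eqD[OF aE bE this] b(2) show False
        by simp
    qed
    moreover have "cd_orth \<gamma> (Suc (Suc m)) x y"
      if "x \<in> cd_line (twist (Suc m) \<epsilon> a)" "y \<in> L" for x y
      using that orth_twist_twist[OF a b g signs] aE bE
      by (auto simp: L cd_line_def intro!: cd_orth_scale)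
    ultimately show ?adj
      unfolding Gamma_e_adj_def
      using twist_line_in_verts[OF a signs zd(1)] twist_line_in_verts[OF b(1) signs' zd(2)] L
      by blast
  }
qed

section \<open>Existence of a generic partner and the low levels\<close>

lemma card_E: "card (cd_E k) = 2 ^ k"
proof (induction k)
  case (Suc k)
  have "finite (cd_E k)"
    by (simp add: cd_E_def)
  moreover have "inj_on (\<lambda>p. CD_Pair p (cd_zero k)) (cd_E k)" "inj_on (CD_Pair (cd_zero k)) (cd_E k)"
    by (auto simp: inj_on_def)
  ultimately show ?case
    unfolding cd_E_Suc using Suc by (subst card_Un_disjoint) (auto simp: card_image)
qed (simp add: cd_E_0)

text \<open>At most five elements are removed from a basis of at least eight.\<close>

lemma E''_diff_nonempty:
  assumes "n \<ge> 3"
  shows "cd_E'' n - {x, y, z} \<noteq> {}"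
proof
  assume "cd_E'' n - {x, y, z} = {}"
  then have "cd_E n \<subseteq> set [cd_one n, cd_te0 n, x, y, z]"
    by (auto simp: cd_E''_def)
  then have "2 ^ n \<le> card (set [cd_one n, cd_te0 n, x, y, z])"
    unfolding card_E[symmetric] by (intro card_mono) auto
  also have "\<dots> \<le> 5"
    using card_length[of "[cd_one n, cd_te0 n, x, y, z]"] by simp
  finally have "2 ^ n \<le> (5 :: nat)" .
  moreover have "(2 :: nat) ^ 3 \<le> 2 ^ n"
    using assms by (intro power_increasing) auto
  ultimately show False
    by simp
qed

text \<open>Here \<open>cd_E'' 2\<close> consists only of \<open>a\<close> and, up to sign, ae, so
  no generic partner exists. In the eight real coordinates of \<open>y\<close>, each of the two
  one-sided equations has only the zero solution.\<close>

lemma not_zero_divisor_level_3: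
  assumes "a \<in> cd_E'' 2" "\<epsilon> \<in> {1, -1}" "\<gamma> 2 = \<gamma> 1"
  shows "\<not> cd_zero_divisor \<gamma> 3 (twist 2 \<epsilon> a)"
proof -
  have a: "a = CD_Pair (CD_Pair (CD_Real 0) (CD_Real 1)) (CD_Pair (CD_Real 0) (CD_Real 0)) \<or>
    a = CD_Pair (CD_Pair (CD_Real 0) (CD_Real 0)) (CD_Pair (CD_Real 0) (CD_Real 1))"
    using assms(1) by (auto simp: cd_E''_def cd_te0_def numeral_2_eq_2 cd_E_Suc cd_E_0)
  obtain p q where g: "\<gamma> 0 = p" "\<gamma> (Suc 0) = q" "\<gamma> (Suc (Suc 0)) = q"
    and nz: "p \<noteq> 0" "q \<noteq> 0" "\<epsilon> \<noteq> 0"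
    and signs: "p = 1 \<or> p = -1" "q = 1 \<or> q = -1" "\<epsilon> = 1 \<or> \<epsilon> = -1"
    using assms(2,3) gamma[of 0] gamma[of 1] by (auto simp: numeral_2_eq_2)
  have "y = cd_zero 3" if y: "y \<in> cd_alg 3"
    and zero: "mul 3 (twist 2 \<epsilon> a) y = cd_zero 3 \<or> mul 3 y (twist 2 \<epsilon> a) = cd_zero 3" for y
  proof -
    have "\<exists>y0 y1 y2 y3 y4 y5 y6 y7. y =
        CD_Pair (CD_Pair (CD_Pair (CD_Real y0) (CD_Real y1)) (CD_Pair (CD_Real y2) (CD_Real y3)))
        (CD_Pair (CD_Pair (CD_Real y4) (CD_Real y5)) (CD_Pair (CD_Real y6) (CD_Real y7)))"
      using y by (auto simp: numeral_3_eq_3)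
    then obtain y0 y1 y2 y3 y4 y5 y6 y7 where y_eq:
      "y = CD_Pair (CD_Pair (CD_Pair (CD_Real y0) (CD_Real y1)) (CD_Pair (CD_Real y2) (CD_Real y3)))
        (CD_Pair (CD_Pair (CD_Real y4) (CD_Real y5)) (CD_Pair (CD_Real y6) (CD_Real y7)))"
      by blast
    note unfold = twist_def cd_tilde_def cd_te0_def numeral_2_eq_2 numeral_3_eq_3 g y_eq nz
    have "y0 = 0 \<and> y1 = 0 \<and> y2 = 0 \<and> y3 = 0 \<and> y4 = 0 \<and> y5 = 0 \<and> y6 = 0 \<and> y7 = 0"
      using a zero
      \<comment> \<open>Four goals: two choices of \<open>a\<close>, two orders of the factors.
        Splitting the signs afterwards makes all coefficients numerical.\<close>
      apply (elim disjE)
         apply (simp_all add: unfold)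
         apply (insert signs)
         apply (elim disjE conjE, simp_all)+
      done
    then show ?thesis
      by (simp add: y_eq numeral_3_eq_3)
  qed
  then show ?thesis
    unfolding cd_zero_divisor_def by blast
qed

text \<open>Up to sign, \<open>a\<close> and ae are basis elements other than 1 and e, so e
  anticommutes with both. This serves the orthogonality to (e, \<epsilon>).\<close>

lemma te0_mult:
  assumes "a \<in> cd_E'' (Suc m)"
  shows "mul (Suc m) (cd_te0 (Suc m)) a = cd_neg (cd_tilde \<gamma> (Suc m) a)"
    and "mul (Suc m) (cd_te0 (Suc m)) (cd_tilde \<gamma> (Suc m) a) = cd_scale (- \<gamma> m) a"
proof -
  consider p where "p \<in> cd_E m" "p \<noteq> cd_one m" "a = CD_Pair p (cd_zero m)"
    | p where "p \<in> cd_E m" "p \<noteq> cd_one m" "a = CD_Pair (cd_zero m) p"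
    using assms by (auto simp: cd_E''_def te0_Suc cd_E_Suc)
  note cases = this
  show "mul (Suc m) (cd_te0 (Suc m)) a = cd_neg (cd_tilde \<gamma> (Suc m) a)"
    using cases by cases (auto simp: te0_Suc cd_conj_E)
  show "mul (Suc m) (cd_te0 (Suc m)) (cd_tilde \<gamma> (Suc m) a) = cd_scale (- \<gamma> m) a"
    using cases by cases (auto simp: te0_Suc cd_conj_E)
qed

end

theorem lemma6p10:
  fixes \<gamma> :: "nat \<Rightarrow> real" and n :: nat and a :: cd and \<epsilon> :: real
  assumes "\<And>k. \<gamma> k \<in> {1, -1}"
    and "n \<ge> 1"
    and "a \<in> cd_E'' n"
    and "\<epsilon> \<in> {1, -1}"
  defines "u \<equiv> CD_Pair (cd_tilde \<gamma> n a) (cd_scale \<epsilon> a)"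
    and "\<chi> \<equiv> \<gamma> n * (cd_norm \<gamma> n (cd_tilde \<gamma> n a) / cd_norm \<gamma> n (cd_scale \<epsilon> a))"
  shows "\<chi> = - \<gamma> (n - 1) * \<gamma> n
    \<and> (\<chi> = 1 \<longrightarrow>
         cd_orth \<gamma> (Suc n) u u
         \<and> cd_orth \<gamma> (Suc n) u (CD_Pair (cd_te0 n) (cd_scale \<epsilon> (cd_one n)))
         \<and> cd_orth \<gamma> (Suc n) u (CD_Pair a (cd_scale (\<epsilon> * \<gamma> n) (cd_tilde \<gamma> n a))))
    \<and> (\<chi> = -1 \<longrightarrow>
         (\<forall>L. Gamma_e_adj \<gamma> n (cd_line u) L \<longleftrightarrow>
            (\<exists>b \<in> cd_E'' n - {a, cd_tilde \<gamma> n a, cd_neg (cd_tilde \<gamma> n a)}.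
               L = cd_line (CD_Pair (cd_tilde \<gamma> n b) (cd_scale (- \<epsilon>) b))))
         \<and> (cd_zero_divisor \<gamma> (Suc n) u \<longleftrightarrow> n \<ge> 3)
         \<and> (u \<in> cd_Ze' \<gamma> n \<or> cd_neg u \<in> cd_Ze' \<gamma> n \<longleftrightarrow> n \<ge> 3))"
proof -
  interpret cd_params \<gamma>
    by unfold_locales (rule assms(1))
  obtain m where n: "n = Suc m"
    using assms(2) by (cases n) auto
  have u: "u = twist (Suc m) \<epsilon> a"
    by (simp add: u_def twist_def n)
  note [simp del] = cd_alg.simps cd_zero.simps cd_mult.simps cd_basis.simps
  let ?k = "Suc m" and ?t = "cd_tilde \<gamma> (Suc m)"
  have a: "a \<in> cd_E'' ?k" and aE: "a \<in> cd_E ?k" "a \<noteq> cd_one ?k" "a \<noteq> cd_te0 ?k"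
    using assms(3) by (auto simp: n cd_E''_def)
  have closed: "a \<in> cd_alg ?k"
    using aE by simp
  obtain \<nu> where \<nu>: "\<nu> \<in> {1, -1}" "mul ?k a (cd_conj a) = cd_scale \<nu> (cd_one ?k)"
    using E_norm[OF aE(1)] by metis
  have "\<epsilon> * \<epsilon> = 1"
    using assms(4) by auto
  have "mul ?k (cd_scale \<epsilon> a) (cd_conj (cd_scale \<epsilon> a)) = cd_scale \<nu> (cd_one ?k)"
    using closed \<nu>(2) \<open>\<epsilon> * \<epsilon> = 1\<close> by (simp add: cd_mult_scale flip: mult.assoc)
  \<comment> \<open>The norms of ae and of \<open>cd_scale \<epsilon> a\<close> are
    \<open>- \<gamma> m * \<nu>\<close> and \<nu>; the sign \<nu> cancels in the quotient.\<close>
  then have \<chi>: "\<chi> = - \<gamma> m * \<gamma> ?k"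
    unfolding \<chi>_def n using \<nu> mult_conj_tilde[OF aE(1) \<nu>(2)] by (auto simp: cd_norm_eqI)

  have part1: "cd_orth \<gamma> (Suc ?k) u u
         \<and> cd_orth \<gamma> (Suc ?k) u (CD_Pair (cd_te0 ?k) (cd_scale \<epsilon> (cd_one ?k)))
         \<and> cd_orth \<gamma> (Suc ?k) u (CD_Pair a (cd_scale (\<epsilon> * \<gamma> ?k) (?t a)))" if "\<chi> = 1"
  proof -
    \<comment> \<open>Both parameters are signs, so \<chi> = 1 means that they are opposite.\<close>
    have g: "\<gamma> ?k = - \<gamma> m"
      using that gamma[of m] gamma[of ?k] by (auto simp: \<chi>)
    have conj: "cd_conj a = cd_neg a" "cd_conj (?t a) = cd_neg (?t a)"
      "cd_conj (cd_te0 ?k) = cd_neg (cd_te0 ?k)"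
      using aE conj_tilde by (auto simp: cd_conj_E te0_Suc)
    have "mul ?k a a = cd_scale (- \<nu>) (cd_one ?k)"
      using arg_cong[OF \<nu>(2), of cd_neg] closed by (simp add: conj cd_mult_scale)
    moreover have "mul ?k (?t a) (?t a) = cd_scale (\<gamma> m * \<nu>) (cd_one ?k)"
      using arg_cong[OF mult_conj_tilde[OF aE(1) \<nu>(2)], of cd_neg] closed
      by (simp add: conj cd_mult_scale)
    moreover have "mul ?k a (cd_te0 ?k) = ?t a" "mul ?k (?t a) (cd_te0 ?k) = cd_scale (\<gamma> m) a"
      using closed tilde_tilde[of a m] by (simp_all add: cd_tilde_def)
    moreover have \<epsilon>_sq: "\<epsilon> * (\<epsilon> * x) = x" for x
      using \<open>\<epsilon> * \<epsilon> = 1\<close> by (simp flip: mult.assoc)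
    \<comment> \<open>With the collected products each component is a sum of two terms that cancel.
      The instance \<open>cd_add_scale[of 1, simplified]\<close> covers sums whose first term
      carries no explicit scalar.\<close>
    ultimately show ?thesis
      using closed te0_mult[OF a] \<open>\<epsilon> * \<epsilon> = 1\<close>
      by (simp add: mult_ac \<epsilon>_sq cd_add_scale[of 1, simplified] cd_orth_def u twist_def conj cd_mult_scale cd_add_scale g
          cd_mult.simps(2)[of \<gamma> ?k] cd_zero.simps(2)[of ?k])
  qed

  have part2: "(\<forall>L. Gamma_e_adj \<gamma> ?k (cd_line u) L \<longleftrightarrow>
            (\<exists>b \<in> cd_E'' ?k - {a, ?t a, cd_neg (?t a)}.
               L = cd_line (CD_Pair (?t b) (cd_scale (- \<epsilon>) b))))
         \<and> (cd_zero_divisor \<gamma> (Suc ?k) u \<longleftrightarrow> ?k \<ge> 3)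
         \<and> (u \<in> cd_Ze' \<gamma> ?k \<or> cd_neg u \<in> cd_Ze' \<gamma> ?k \<longleftrightarrow> ?k \<ge> 3)" if "\<chi> = - 1"
  proof -
    have g: "\<gamma> ?k = \<gamma> m"
      using that gamma[of m] gamma[of ?k] by (auto simp: \<chi>)
    have zd: "cd_zero_divisor \<gamma> (Suc ?k) u \<longleftrightarrow> ?k \<ge> 3"
    proof
      assume "?k \<ge> 3"
      then obtain b where "b \<in> cd_E'' ?k" "b \<noteq> a" "\<not> cd_sim b (?t a)"
        using E''_diff_nonempty E''_diff_iff by blast
      then show "cd_zero_divisor \<gamma> (Suc ?k) u"
        unfolding u using twist_zero_divisor(1) a g assms(4) by blast
    next
      assume *: "cd_zero_divisor \<gamma> (Suc ?k) u"
      \<comment> \<open>For \<open>n = 1\<close> the basis is {1, e}, so \<open>cd_E''\<close> is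
        empty.\<close>
      have "m \<noteq> 0"
        using aE by (auto simp: cd_E_Suc cd_E_0 te0_Suc cd_basis.simps cd_zero.simps)
      moreover have "m \<noteq> 1"
        using * not_zero_divisor_level_3[of a \<epsilon>] a g assms(4)
        by (auto simp: u numeral_2_eq_2 numeral_3_eq_3)
      ultimately show "?k \<ge> 3"
        by simp
    qed
    have "u \<in> cd_Ze' \<gamma> ?k \<or> cd_neg u \<in> cd_Ze' \<gamma> ?k \<longleftrightarrow> cd_zero_divisor \<gamma> (Suc ?k) u"
    proof
      assume "u \<in> cd_Ze' \<gamma> ?k \<or> cd_neg u \<in> cd_Ze' \<gamma> ?k"
      then have "cd_zero_divisor \<gamma> (Suc ?k) u \<or> cd_zero_divisor \<gamma> (Suc ?k) (cd_neg u)"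
        by (auto simp: cd_Ze'_def)
      then show "cd_zero_divisor \<gamma> (Suc ?k) u"
        using zero_divisor_scale[of "-1" "Suc ?k" "cd_neg u"] by auto
    next
      assume "cd_zero_divisor \<gamma> (Suc ?k) u"
      then obtain s where "s \<in> {1, -1}" "cd_scale s u \<in> cd_Ze' \<gamma> ?k"
        using twist_scale_in_Ze'[OF a assms(4)] unfolding u by metis
      then show "u \<in> cd_Ze' \<gamma> ?k \<or> cd_neg u \<in> cd_Ze' \<gamma> ?k"
        by auto
    qed
    with zd twist_line_adj_iff[OF a assms(4) g] show ?thesis
      by (simp add: u twist_def)
  qed

  show ?thesis
    unfolding n diff_Suc_1 by (rule conjI[OF \<chi> conjI[OF impI[OF part1] impI[OF part2]]])
qed

end
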